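(* Let $j\geq 2$. Then for every $n>j$ there exists a bijection between $\bar{\mathcal{I}}_n^{\{1,j\}}$ and $\Pi_{n-1}^{\{-2,-1,j-2\}}$.
   Context: A composition of $n$ is an ordered list of positive integers (parts) with sum $n$. A meander on $n$ nodes is a pair $\frac{\lambda}{\mu}$ of compositions $\lambda=(\lambda_1,\dots,\lambda_r)$, $\mu=(\mu_1,\dots,\mu_s)$ of $n$. The direct sum of $\frac{\lambda}{\mu}$ and $\frac{\lambda'}{\mu'}$ is the meander obtained by concatenating $\lambda$ with $\lambda'$ and $\mu$ with $\mu'$. A meander is indecomposable if it is not the direct sum of strictly smaller (nonempty) meanders; equivalently, the sets of partial sums $\{\lambda_1,\lambda_1+\lambda_2,\dots,n\}$ and $\{\mu_1,\mu_1+\mu_2,\dots,n\}$ intersect only in $\{n\}$. $\bar{\mathcal{I}}_n^{\{1,j\}}$ is the set of indecomposable meanders $\frac{\lambda}{\mu}$ on $n$ nodes with all parts of $\lambda$ and $\mu$ in $\{1,j\}$ and with $\lambda_1>\mu_1$. For a set $D$ of integers, $\Pi_m^{D}$ is the set of permutations $\pi=\pi_1\cdots\pi_m$ of $\{1,\dots,m\}$ such that every displacement $\pi_i-i$ ($1\le i\le m$) lies in $D$. *)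

theory Defs
  imports Main "HOL-Combinatorics.Permutations"
begin

definition composition :: "nat \<Rightarrow> nat list \<Rightarrow> bool" where
  "composition n xs \<longleftrightarrow> (\<forall>x\<in>set xs. 0 < x) \<and> sum_list xs = n"

text \<open>A meander is the pair \<open>(\<lambda>, \<mu>)\<close> of its top and bottom compositions.\<close>

type_synonym meander = "nat list \<times> nat list"

definition is_meander :: "nat \<Rightarrow> meander \<Rightarrow> bool" where
  "is_meander n M \<longleftrightarrow> composition n (fst M) \<and> composition n (snd M)"

definition direct_sum :: "meander \<Rightarrow> meander \<Rightarrow> meander" where
  "direct_sum M M' = (fst M @ fst M', snd M @ snd M')"

text \<open>Two summands suffice, since the direct sum is associative.\<close>

definition indecomposable :: "meander \<Rightarrow> bool" where
  "indecomposable M \<longleftrightarrow>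
     \<not> (\<exists>a b A B. 0 < a \<and> 0 < b \<and> is_meander a A \<and> is_meander b B \<and> M = direct_sum A B)"

text \<open>For \<open>n > 0\<close> both compositions are nonempty, so the two uses of \<^const>\<open>hd\<close> are the
  first parts \<open>\<lambda>\<^sub>1\<close> and \<open>\<mu>\<^sub>1\<close>; the case \<open>n = 0\<close> is not meaningful.\<close>

definition indec_meanders_gt :: "nat set \<Rightarrow> nat \<Rightarrow> meander set" where
  "indec_meanders_gt S n =
     {M. is_meander n M \<and> indecomposable M \<and>
         set (fst M) \<subseteq> S \<and> set (snd M) \<subseteq> S \<and> hd (fst M) > hd (snd M)}"

definition displacement_perms :: "int set \<Rightarrow> nat \<Rightarrow> (nat \<Rightarrow> nat) set" where
  "displacement_perms D m =
     {\<pi>. \<pi> permutes {1..m} \<and> (\<forall>i\<in>{1..m}. int (\<pi> i) - int i \<in> D)}"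

end

theory Submission
  imports Defs "HOL-Library.Equipollence"
begin

text \<open>
  Build an indecomposable meander by always extending the shorter of its two compositions. The
  amount \<open>d\<close> by which the other one is ahead lies in \<open>{1..<j}\<close>: adding the part \<open>1\<close> gives
  \<open>d \<rightarrow> d - 1\<close> and moves the shorter partial sum by \<open>1\<close>; adding the part \<open>j\<close> exchanges the roles,
  gives \<open>d \<rightarrow> j - d\<close> and moves the shorter partial sum by \<open>d\<close>. The condition
  \<open>\<lambda>\<^sub>1 > \<mu>\<^sub>1\<close> means that the walk starts in state \<open>j - 1\<close>; it ends when \<open>d\<close> reaches \<open>0\<close>.

  Reading a permutation from left to right, exactly two values of the window
  \<open>{i - 1..i + j - 2}\<close> are used after \<open>i\<close> steps. Whenever the smallest value of the window is one
  of them, let \<open>d\<close> be the distance to the other. A displacement \<open>-1\<close> gives \<open>d \<rightarrow> d - 1\<close> in one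
  step; a displacement \<open>j - 2\<close> followed by \<open>d - 1\<close> forced displacements \<open>-2\<close> gives
  \<open>d \<rightarrow> j - d\<close> in \<open>d\<close> steps. These walks start and end in state \<open>1\<close>. The first
  step to \<open>j - 1\<close> is forced, and so is the last step from \<open>1\<close> to \<open>0\<close> of a meander, so both sides count
  the same walks.
\<close>

section \<open>Meanders\<close>

text \<open>Both 0 and the total belong to the set, which gives a clean recursion on the head of the
  list; the index is unbounded because \<open>take\<close> saturates.\<close>

definition partial_sums :: "nat list \<Rightarrow> nat set" where
  "partial_sums xs = range (\<lambda>i. sum_list (take i xs))"

lemma partial_sums_Nil [simp]: "partial_sums [] = {0}"
  by (simp add: partial_sums_def)

lemma partial_sums_Cons: "partial_sums (x # xs) = insert 0 ((+) x ` partial_sums xs)"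
proof -
  have "UNIV = insert 0 (range Suc)"
    using not0_implies_Suc by auto
  then have "range (\<lambda>i. sum_list (take i (x # xs)))
      = (\<lambda>i. sum_list (take i (x # xs))) ` insert 0 (range Suc)"
    by metis
  also have "\<dots> = insert 0 ((+) x ` partial_sums xs)"
    by (simp add: partial_sums_def image_image)
  finally show ?thesis by (simp add: partial_sums_def)
qed

lemma zero_in_partial_sums [simp]: "0 \<in> partial_sums xs"
  by (cases xs) (simp_all add: partial_sums_Cons)

lemma partial_sums_le: "p \<in> partial_sums xs \<Longrightarrow> p \<le> sum_list xs"
  by (induction xs arbitrary: p) (auto simp: partial_sums_Cons)

lemma partial_sums_append: "sum_list xs \<in> partial_sums (xs @ ys)"
  unfolding partial_sums_def by (rule range_eqI[of _ _ "length xs"]) simp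

text \<open>A common partial sum strictly between 0 and \<open>n\<close> is exactly a place where
  both rows can be cut at once.\<close>

lemma indecomposable_iff_partial_sums:
  assumes "is_meander n (xs, ys)"
  shows "indecomposable (xs, ys) \<longleftrightarrow> partial_sums xs \<inter> partial_sums ys \<subseteq> {0, n}"
proof
  assume indec: "indecomposable (xs, ys)"
  show "partial_sums xs \<inter> partial_sums ys \<subseteq> {0, n}"
  proof
    fix p assume p: "p \<in> partial_sums xs \<inter> partial_sums ys"
    then obtain i k where ik: "p = sum_list (take i xs)" "p = sum_list (take k ys)"
      unfolding partial_sums_def by blast
    have "p \<le> n"
      using p assms partial_sums_le[of p xs] by (auto simp: is_meander_def composition_def)
    show "p \<in> {0, n}"
    proof (rule ccontr)
      assume "p \<notin> {0, n}"
      then have "0 < p" "0 < n - p" using \<open>p \<le> n\<close> by auto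
      moreover have "is_meander p (take i xs, take k ys)"
        using assms ik by (auto simp: is_meander_def composition_def dest: in_set_takeD)
      moreover have "sum_list (take i xs) + sum_list (drop i xs) = n"
                    "sum_list (take k ys) + sum_list (drop k ys) = n"
        using assms
        by (simp_all add: is_meander_def composition_def flip: sum_list_append)
      then have "is_meander (n - p) (drop i xs, drop k ys)"
        using assms ik by (auto simp: is_meander_def composition_def dest: in_set_dropD)
      moreover have "(xs, ys) = direct_sum (take i xs, take k ys) (drop i xs, drop k ys)"
        by (simp add: direct_sum_def)
      ultimately show False using indec unfolding indecomposable_def by blast
    qed
  qed
next
  assume sub: "partial_sums xs \<inter> partial_sums ys \<subseteq> {0, n}"
  show "indecomposable (xs, ys)"
    unfolding indecomposable_def
  proof clarify
    fix a b A1 A2 B1 B2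
    assume *: "0 < a" "0 < b" "is_meander a (A1, A2)" "is_meander b (B1, B2)"
      "(xs, ys) = direct_sum (A1, A2) (B1, B2)"
    then have "a \<in> partial_sums xs \<inter> partial_sums ys"
      using partial_sums_append[of A1 B1] partial_sums_append[of A2 B2]
      by (auto simp: direct_sum_def is_meander_def composition_def)
    moreover have "n = a + b"
      using * assms by (auto simp: direct_sum_def is_meander_def composition_def)
    ultimately show False using sub \<open>0 < a\<close> \<open>0 < b\<close> by auto
  qed
qed

text \<open>Completions of a partial meander whose first row is ahead by \<open>d\<close>, where the second row
  still has to cover \<open>r\<close> nodes.\<close>

definition completions :: "nat \<Rightarrow> nat \<Rightarrow> nat \<Rightarrow> meander set" where
  "completions j d r =
     {(xs, ys). set xs \<subseteq> {1, j} \<and> set ys \<subseteq> {1, j} \<and> d + sum_list xs = r \<and> sum_list ys = r \<and>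
        (+) d ` partial_sums xs \<inter> partial_sums ys \<subseteq> {r}}"

section \<open>Recursion for completions\<close>

lemma completions_empty: "r < d \<Longrightarrow> completions j d r = {}"
  by (auto simp: completions_def)

lemma completions_0:
  assumes "0 < j"
  shows "completions j 0 r = (if r = 0 then {([], [])} else {})"
proof -
  have "r = 0 \<and> xs = [] \<and> ys = []" if *: "(xs, ys) \<in> completions j 0 r" for xs ys
  proof -
    have parts: "set xs \<subseteq> {1, j}" "set ys \<subseteq> {1, j}" "sum_list xs = r" "sum_list ys = r"
      and sums: "(+) 0 ` partial_sums xs \<inter> partial_sums ys \<subseteq> {r}"
      using * by (simp_all add: completions_def)
    have "0 \<in> (+) 0 ` partial_sums xs \<inter> partial_sums ys" by simp
    then have "r = 0" using sums by blast
    moreover have "0 \<notin> set xs" "0 \<notin> set ys" using parts(1,2) assms by fastforce+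
    ultimately show ?thesis using parts(3,4) by (cases xs; cases ys) simp_all
  qed
  moreover have "([], []) \<in> completions j 0 0" by (simp add: completions_def)
  ultimately show ?thesis by auto
qed

text \<open>The origin moves by 1. Since \<open>0 < d\<close>, the discarded partial sum 0 of the
  second row is no meeting point.\<close>

lemma completions_step_1:
  assumes "0 < d"
  shows "(xs, 1 # ys) \<in> completions j d (Suc r) \<longleftrightarrow> (xs, ys) \<in> completions j (d - 1) r"
proof -
  have "(+) d ` A \<inter> insert 0 ((+) 1 ` B) \<subseteq> {Suc r} \<longleftrightarrow> (+) (d - 1) ` A \<inter> B \<subseteq> {r}"
    for A B :: "nat set"
    using assms by (cases d) (auto simp: subset_iff image_iff)
  then show ?thesis
    using assms by (auto simp: completions_def partial_sums_Cons)
qed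

text \<open>The origin moves by \<open>d\<close>, to the old end of the first row. From there the
  second row is ahead by \<open>j - d\<close>, so the rows change places.\<close>

lemma completions_step_j:
  assumes "0 < d" "d < j" "d \<le> r"
  shows "(xs, j # ys) \<in> completions j d r \<longleftrightarrow> (ys, xs) \<in> completions j (j - d) (r - d)"
proof -
  obtain e s where "j = d + e" "r = d + s"
    using assms by (metis le_Suc_ex less_imp_le_nat)
  moreover have "(+) d ` A \<inter> insert 0 ((+) (d + e) ` B) \<subseteq> {d + s} \<longleftrightarrow> (+) e ` B \<inter> A \<subseteq> {s}"
    for A B :: "nat set"
    using assms by (auto simp: subset_iff image_iff)
  ultimately show ?thesis
    by (auto simp: completions_def partial_sums_Cons)
qed

lemma completions_rec:
  assumes "0 < d" "d < j" "d \<le> Suc r"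
  shows "completions j d (Suc r) =
    (\<lambda>(xs, ys). (xs, 1 # ys)) ` completions j (d - 1) r \<union>
    (\<lambda>(ys, xs). (xs, j # ys)) ` completions j (j - d) (Suc r - d)"
proof -
  have "M \<in> completions j d (Suc r) \<longleftrightarrow>
      M \<in> (\<lambda>(xs, ys). (xs, 1 # ys)) ` completions j (d - 1) r \<or>
      M \<in> (\<lambda>(ys, xs). (xs, j # ys)) ` completions j (j - d) (Suc r - d)" for M
  proof (cases "\<exists>xs ys. M = (xs, 1 # ys) \<or> M = (xs, j # ys)")
    case True
    then obtain xs ys where "M = (xs, 1 # ys) \<or> M = (xs, j # ys)" by blast
    then show ?thesis
    proof
      assume M: "M = (xs, 1 # ys)"
      \<comment> \<open>Keeps the images of the two branches apart.\<close>
      have "j \<noteq> 1" using assms by simp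
      then show ?thesis
        unfolding M completions_step_1[OF assms(1)] by force
    next
      assume M: "M = (xs, j # ys)"
      have "j \<noteq> 1" using assms by simp
      then show ?thesis
        unfolding M completions_step_j[OF assms] by force
    qed
  next
    case False
    have "M \<notin> completions j d (Suc r)"
    proof
      assume M: "M \<in> completions j d (Suc r)"
      obtain xs ys where xy: "M = (xs, ys)" by (cases M)
      then have "set ys \<subseteq> {1, j}" "sum_list ys = Suc r"
        using M by (simp_all add: completions_def)
      then show False using False xy by (cases ys) auto
    qed
    then show ?thesis using False by auto
  qed
  then show ?thesis by blast
qed

text \<open>With parts in \<open>{1, j}\<close>, a strictly larger first part on top can only be
  \<open>j\<close> over 1, which is the state \<open>j - 1\<close>.\<close>

lemma indec_meanders_gt_eq:
  assumes "2 \<le> j" "0 < n"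
  shows "indec_meanders_gt {1, j} n =
    (\<lambda>(xs, ys). (j # xs, 1 # ys)) ` completions j (j - 1) (n - 1)"
proof -
  have step: "(j # xs, 1 # ys) \<in> indec_meanders_gt {1, j} n \<longleftrightarrow>
      (xs, ys) \<in> completions j (j - 1) (n - 1)" for xs ys
  proof (cases "is_meander n (j # xs, 1 # ys)")
    case True
    obtain k m where km: "j = Suc (Suc k)" "n = Suc m"
      using assms by (metis Suc_diff_1 add_2_eq_Suc le_Suc_ex)
    \<comment> \<open>The common start 0 is permitted by \<open>{0, n}\<close> and drops out; then
      the origin moves by 1.\<close>
    have "insert 0 ((+) j ` A) \<inter> insert 0 ((+) 1 ` B) \<subseteq> {0, n} \<longleftrightarrow>
        (+) (j - 1) ` A \<inter> B \<subseteq> {n - 1}" for A B :: "nat set"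
      using km by (auto simp: subset_iff image_iff)
    then show ?thesis
      using True assms indecomposable_iff_partial_sums[OF True]
      by (auto simp: indec_meanders_gt_def completions_def partial_sums_Cons is_meander_def
          composition_def)
  next
    case False
    then show ?thesis
      using assms
      by (auto simp: indec_meanders_gt_def completions_def is_meander_def composition_def)
  qed
  have shape: "\<exists>xs' ys'. xs = j # xs' \<and> ys = 1 # ys'"
    if "(xs, ys) \<in> indec_meanders_gt {1, j} n" for xs ys
    using that assms
    by (cases xs; cases ys) (auto simp: indec_meanders_gt_def is_meander_def composition_def)
  show ?thesis
  proof (intro equalityI subsetI)
    fix M assume M: "M \<in> indec_meanders_gt {1, j} n"
    obtain xs ys where xy: "M = (j # xs, 1 # ys)"
      using shape M by (cases M) blast
    then have "(xs, ys) \<in> completions j (j - 1) (n - 1)"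
      using M step by simp
    then show "M \<in> (\<lambda>(xs, ys). (j # xs, 1 # ys)) ` completions j (j - 1) (n - 1)"
      by (rule rev_image_eqI) (simp add: xy)
  next
    fix M assume "M \<in> (\<lambda>(xs, ys). (j # xs, 1 # ys)) ` completions j (j - 1) (n - 1)"
    then show "M \<in> indec_meanders_gt {1, j} n"
      using step by (auto simp del: One_nat_def)
  qed
qed

section \<open>Permutations\<close>

text \<open>A permutation is encoded by the word \<open>w\<close> of its displacements, increased by \<open>2\<close>. Relative to
  a window that starts two below the current position, \<open>T\<close> is the set of values already used.\<close>

fun fills :: "nat \<Rightarrow> nat set \<Rightarrow> nat list \<Rightarrow> bool" where
  "fills j T [] \<longleftrightarrow> T = {0, 1}"
| "fills j T (x # w) \<longleftrightarrow>
     x \<in> {0, 1, j} \<and> x \<notin> T \<and> 0 \<in> insert x T \<and> fills j (Suc -` insert x T) w"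

definition fillings :: "nat \<Rightarrow> nat set \<Rightarrow> nat \<Rightarrow> nat list set" where
  "fillings j T r = {w. length w = r \<and> fills j T w}"

section \<open>Words as bijections and their recursion\<close>

lemma bij_betw_lessThan_Suc:
  "bij_betw f {..<Suc l} B \<longleftrightarrow> f 0 \<in> B \<and> bij_betw (f \<circ> Suc) {..<l} (B - {f 0})"
proof -
  have "0 \<notin> Suc ` {..<l}" by auto
  then have "inj_on f (insert 0 (Suc ` {..<l})) \<longleftrightarrow>
      f 0 \<notin> f ` Suc ` {..<l} \<and> inj_on f (Suc ` {..<l})"
    by (auto simp: inj_on_insert)
  then show ?thesis
    unfolding lessThan_Suc_eq_insert_0 bij_betw_def image_insert image_comp[symmetric]
    by (simp only: comp_inj_on_iff[OF inj_Suc, symmetric]) blast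
qed

lemma bij_betw_Suc_comp:
  "bij_betw (Suc \<circ> g) A C \<longleftrightarrow> 0 \<notin> C \<and> bij_betw g A (Suc -` C)"
proof -
  have "Suc ` g ` A = C \<longleftrightarrow> 0 \<notin> C \<and> g ` A = Suc -` C"
    by (auto simp: image_iff) (metis not0_implies_Suc)+
  then show ?thesis
    by (auto simp: bij_betw_def inj_on_def image_comp)
qed

text \<open>Turns the letterwise check into a global one. In the induction, later positions cannot
  reach the value 0, so it must be covered now; the remaining indices and values shift down by
  one.\<close>

lemma fills_iff_bij_betw:
  "fills j T w \<longleftrightarrow> set w \<subseteq> {0, 1, j} \<and> T \<subseteq> {..<length w + 2} \<and>
     bij_betw (\<lambda>i. i + w ! i) {..<length w} ({..<length w + 2} - T)"
proof (induction w arbitrary: T)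
  case Nil
  have "{..<2} = {0, 1 :: nat}" by auto
  then have "T = {0, 1} \<longleftrightarrow> T \<subseteq> {..<2} \<and> {} = {..<2} - T" by blast
  then show ?case by (simp add: bij_betw_def numeral_2_eq_2)
next
  case (Cons x w)
  let ?l = "length w"
  let ?B = "{..<Suc ?l + 2} - T"
  have comp: "(\<lambda>i. i + (x # w) ! i) \<circ> Suc = Suc \<circ> (\<lambda>i. i + w ! i)"
    by (simp add: fun_eq_iff)
  have "bij_betw (\<lambda>i. i + (x # w) ! i) {..<Suc ?l} ?B \<longleftrightarrow>
      x \<in> ?B \<and> 0 \<notin> ?B - {x} \<and> bij_betw (\<lambda>i. i + w ! i) {..<?l} (Suc -` (?B - {x}))"
    by (simp add: bij_betw_lessThan_Suc comp bij_betw_Suc_comp)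
  also have "Suc -` (?B - {x}) = {..<?l + 2} - Suc -` insert x T"
    by auto
  finally have bij: "bij_betw (\<lambda>i. i + (x # w) ! i) {..<Suc ?l} ?B \<longleftrightarrow>
      x \<in> ?B \<and> 0 \<notin> ?B - {x} \<and>
      bij_betw (\<lambda>i. i + w ! i) {..<?l} ({..<?l + 2} - Suc -` insert x T)" .
  \<comment> \<open>The preimage forgets only 0, which is in range anyway.\<close>
  have sub: "Suc -` insert x T \<subseteq> {..<?l + 2} \<longleftrightarrow> insert x T \<subseteq> {..<Suc ?l + 2}"
  proof
    assume *: "Suc -` insert x T \<subseteq> {..<?l + 2}"
    show "insert x T \<subseteq> {..<Suc ?l + 2}"
    proof
      fix t assume "t \<in> insert x T"
      then show "t \<in> {..<Suc ?l + 2}" using * by (cases t) auto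
    qed
  qed auto
  have "0 \<in> {..<Suc ?l + 2}" by simp
  then show ?case
    unfolding fills.simps Cons.IH sub list.size(4) list.set(2) add_Suc_right add_0_right bij
    by blast
qed

lemma fillings_shift:
  assumes "a < c"
  shows "fillings j {a, c} r \<approx> (if a \<le> r then fillings j {0, c - a} (r - a) else {})"
  using assms
proof (induction a arbitrary: c r)
  case (Suc a)
  show ?case
  proof (cases r)
    case 0
    then show ?thesis using Suc.prems by (auto simp: fillings_def)
  next
    case (Suc s)
    have "Suc -` {0, Suc a, c} = {a, c - 1}"
      using Suc.prems by auto
    then have "fillings j {Suc a, c} (Suc s) = (#) 0 ` fillings j {a, c - 1} s"
      using Suc.prems by (auto simp: fillings_def length_Suc_conv)
    then have "fillings j {Suc a, c} r \<approx> fillings j {a, c - 1} s"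
      using Suc by simp
    also have "\<dots> \<approx> (if a \<le> s then fillings j {0, c - 1 - a} (s - a) else {})"
      using Suc.prems by (intro Suc.IH) auto
    finally show ?thesis using Suc by (simp split: if_splits)
  qed
qed simp

text \<open>The letter 0 is taken, and 1 is free unless \<open>d = 1\<close>; afterwards 0 leaves
  the window.\<close>

lemma fillings_rec:
  assumes "0 < d" "d < j"
  shows "fillings j {0, d} (Suc r) =
    (#) 1 ` (if d = 1 then {} else fillings j {0, d - 1} r) \<union> (#) j ` fillings j {d - 1, j - 1} r"
proof -
  have vimage: "Suc -` {1, 0, d} = {0, d - 1}" "Suc -` {j, 0, d} = {d - 1, j - 1}"
    using assms by auto
  have *: "fills j {0, d} (x # w) \<longleftrightarrow>
      x = 1 \<and> d \<noteq> 1 \<and> fills j {0, d - 1} w \<or> x = j \<and> fills j {d - 1, j - 1} w" for x w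
  proof -
    consider "x = 1" "j \<noteq> 1" | "x = j" "j \<noteq> 1" "j \<noteq> d" | "x \<noteq> 1" "x \<noteq> j"
      using assms by fastforce
    then show ?thesis
    proof cases
      case 1
      then show ?thesis unfolding fills.simps 1(1) vimage using 1(2) by auto
    next
      case 2
      then show ?thesis unfolding fills.simps 2(1) vimage using assms by blast
    qed auto
  qed
  show ?thesis
  proof (rule set_eqI)
    fix w
    show "w \<in> fillings j {0, d} (Suc r) \<longleftrightarrow> w \<in>
      (#) 1 ` (if d = 1 then {} else fillings j {0, d - 1} r) \<union> (#) j ` fillings j {d - 1, j - 1} r"
    proof (cases w)
      case (Cons x v)
      show ?thesis
        unfolding Cons fillings_def mem_Collect_eq * by auto
    qed (auto simp: fillings_def)
  qed
qed

lemma fillings_empty: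
  assumes "Suc r < d"
  shows "fillings j {0, d} r = {}"
proof -
  have False if "w \<in> fillings j {0, d} r" for w
  proof -
    have "{0, d} \<subseteq> {..<r + 2}"
      using that unfolding fillings_def fills_iff_bij_betw mem_Collect_eq by blast
    then show False using assms by simp
  qed
  then show ?thesis by blast
qed

text \<open>The initial set \<open>{0, 1}\<close> stands for the nonexistent values -1 and 0, which
  count as used.\<close>

lemma displacement_perms_eqpoll_fillings:
  assumes "2 \<le> j"
  shows "displacement_perms {-2, -1, int j - 2} m \<approx> fillings j {0, 1} m"
proof -
  \<comment> \<open>\<open>F\<close> records the displacement of \<open>Suc i\<close> plus 2.
    \<open>G\<close> inverts it and is the identity outside \<open>{1..m}\<close>, as
    \<open>permutes\<close> demands.\<close>
  define F where "F \<pi> = map (\<lambda>i. Suc (\<pi> (Suc i)) - i) [0..<m]" for \<pi> :: "nat \<Rightarrow> nat"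
  define G where "G w p = (if p \<in> {1..m} then p + w ! (p - 1) - 2 else p)" for w :: "nat list" and p
  let ?P = "displacement_perms {-2, -1, int j - 2} m"
  have fill_iff: "w \<in> fillings j {0, 1} m \<longleftrightarrow> length w = m \<and> set w \<subseteq> {0, 1, j} \<and>
      bij_betw (\<lambda>i. i + w ! i) {..<m} {2..<m + 2}" for w
  proof -
    have "{..<m + 2} - {0, 1} = {2..<m + 2}" by auto
    then show ?thesis
      unfolding fillings_def fills_iff_bij_betw mem_Collect_eq by (cases "length w = m") simp_all
  qed
  have shift: "bij_betw (\<lambda>i. Suc (\<pi> (Suc i))) {..<m} {2..<m + 2} \<longleftrightarrow> bij_betw \<pi> {1..m} {1..m}"
    for \<pi> :: "nat \<Rightarrow> nat"
  proof -
    have "Suc -` {2..<m + 2} = {1..m}" by auto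
    then have "bij_betw (Suc \<circ> (\<pi> \<circ> Suc)) {..<m} {2..<m + 2} \<longleftrightarrow> bij_betw (\<pi> \<circ> Suc) {..<m} {1..m}"
      unfolding bij_betw_Suc_comp by simp
    also have "bij_betw Suc {..<m} {1..m}"
      by (simp add: bij_betw_def image_Suc_lessThan)
    then have "bij_betw (\<pi> \<circ> Suc) {..<m} {1..m} \<longleftrightarrow> bij_betw \<pi> {1..m} {1..m}"
      by (rule bij_betw_comp_iff[symmetric])
    finally show ?thesis by (simp add: comp_def)
  qed
  have F: "i + F \<pi> ! i = Suc (\<pi> (Suc i))" "F \<pi> ! i \<in> {0, 1, j}" if "\<pi> \<in> ?P" "i < m" for \<pi> i
  proof -
    have "\<forall>i\<in>{1..m}. int (\<pi> i) - int i \<in> {-2, -1, int j - 2}" "Suc i \<in> {1..m}"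
      using that by (simp_all add: displacement_perms_def)
    then have "int (\<pi> (Suc i)) - int (Suc i) \<in> {-2, -1, int j - 2}"
      by (rule bspec)
    moreover have "F \<pi> ! i = Suc (\<pi> (Suc i)) - i"
      using that by (simp add: F_def)
    ultimately show "i + F \<pi> ! i = Suc (\<pi> (Suc i))" "F \<pi> ! i \<in> {0, 1, j}"
      using assms by auto
  qed
  have G: "Suc (G w (Suc i)) = i + w ! i" if "w \<in> fillings j {0, 1} m" "i < m" for w i
  proof -
    have "bij_betw (\<lambda>i. i + w ! i) {..<m} {2..<m + 2}"
      using that by (simp only: fill_iff)
    \<comment> \<open>The lower bound 2 ensures that the subtraction in \<open>G\<close> is not
      truncated.\<close>
    then have "i + w ! i \<in> {2..<m + 2}"
      using that(2) by (blast dest: bij_betwE)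
    then show ?thesis using that(2) by (auto simp: G_def)
  qed
  have "bij_betw F ?P (fillings j {0, 1} m)"
  proof (rule bij_betw_byWitness[where f' = G])
    show "\<forall>\<pi>\<in>?P. G (F \<pi>) = \<pi>"
    proof
      fix \<pi> assume \<pi>: "\<pi> \<in> ?P"
      show "G (F \<pi>) = \<pi>"
      proof
        fix p
        show "G (F \<pi>) p = \<pi> p"
        proof (cases "p \<in> {1..m}")
          case True
          then obtain i where "p = Suc i" "i < m"
            by (cases p) auto
          then show ?thesis using F(1)[OF \<pi>, of i] by (simp add: G_def)
        next
          case False
          then show ?thesis
            using \<pi> by (simp only: G_def if_False) (simp add: displacement_perms_def permutes_def)
        qed
      qed
    qed
    show "\<forall>w\<in>fillings j {0, 1} m. F (G w) = w"
    proof
      fix w assume w: "w \<in> fillings j {0, 1} m"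
      then have "length w = m" by (simp only: fill_iff)
      then show "F (G w) = w"
        by (intro nth_equalityI) (simp_all add: F_def G[OF w])
    qed
    show "F ` ?P \<subseteq> fillings j {0, 1} m"
    proof clarify
      fix \<pi> assume \<pi>: "\<pi> \<in> ?P"
      have len: "length (F \<pi>) = m" by (simp add: F_def)
      have "bij_betw \<pi> {1..m} {1..m}"
        using \<pi> by (simp add: displacement_perms_def permutes_imp_bij)
      then have "bij_betw (\<lambda>i. Suc (\<pi> (Suc i))) {..<m} {2..<m + 2}"
        by (simp only: shift)
      then have "bij_betw (\<lambda>i. i + F \<pi> ! i) {..<m} {2..<m + 2}"
        by (rule bij_betw_cong[THEN iffD1, rotated]) (use F(1)[OF \<pi>] in simp)
      moreover have "set (F \<pi>) \<subseteq> {0, 1, j}"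
        using F(2)[OF \<pi>] len by (metis in_set_conv_nth subsetI)
      ultimately show "F \<pi> \<in> fillings j {0, 1} m"
        using len unfolding fill_iff by blast
    qed
    show "G ` fillings j {0, 1} m \<subseteq> ?P"
    proof clarify
      fix w assume w: "w \<in> fillings j {0, 1} m"
      have "bij_betw (\<lambda>i. i + w ! i) {..<m} {2..<m + 2}"
        using w by (simp only: fill_iff)
      then have "bij_betw (\<lambda>i. Suc (G w (Suc i))) {..<m} {2..<m + 2}"
        by (rule bij_betw_cong[THEN iffD1, rotated]) (use G[OF w] in simp)
      then have "bij_betw (G w) {1..m} {1..m}"
        by (simp only: shift)
      then have "G w permutes {1..m}"
        by (rule bij_imp_permutes) (simp only: G_def if_False)
      moreover have "int (G w p) - int p \<in> {-2, -1, int j - 2}" if p: "p \<in> {1..m}" for p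
      proof -
        obtain i where i: "p = Suc i" "i < m"
          using p by (cases p) auto
        have "set w \<subseteq> {0, 1, j}" "length w = m"
          using w by (simp_all only: fill_iff)
        then have "w ! i \<in> {0, 1, j}"
          using i(2) nth_mem by blast
        moreover have "int (G w p) - int p = int (w ! i) - 2"
          using G[OF w i(2)] i(1) by simp
        ultimately show ?thesis by auto
      qed
      ultimately show "G w \<in> ?P" unfolding displacement_perms_def by blast
    qed
  qed
  then show ?thesis by (auto simp: eqpoll_def)
qed

section \<open>Comparison\<close>

text \<open>Both families follow the same walk. Meanders need one node more, for the closing step
  from 1 to 0.\<close>

lemma completions_eqpoll_fillings:
  assumes "0 < d" "d < j"
  shows "completions j d (Suc r) \<approx> fillings j {0, d} r"
  using assms
proof (induction r arbitrary: d rule: less_induct)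
  case (less r)
  show ?case
  proof (cases "d \<le> Suc r")
    case False
    then show ?thesis using completions_empty fillings_empty by simp
  next
    case True
    let ?f = "\<lambda>(xs, ys). (xs, 1 # ys)" and ?g = "\<lambda>(ys, xs). (xs, j # ys)"
    note rec = completions_rec[OF less.prems True]
    show ?thesis
    proof (cases r)
      case 0
      with True less.prems have d: "d = 1" by simp
      have "completions j d (Suc r) = {([], [1])}"
        unfolding rec using 0 d less.prems by (simp add: completions_0 completions_empty)
      moreover have "fillings j {0, d} r = {[]}"
        using 0 d by (auto simp: fillings_def)
      ultimately show ?thesis by (simp add: eqpoll_iff_card)
    next
      case (Suc q)
      \<comment> \<open>For \<open>d = 1\<close> both sides are empty: the rows would meet too
        early, and the letter 1 is already used.\<close>
      have 1: "completions j (d - 1) r \<approx> (if d = 1 then {} else fillings j {0, d - 1} q)"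
        using less.IH[of q "d - 1"] less.prems Suc by (auto simp: completions_0)
      \<comment> \<open>Words spend \<open>d\<close> letters here, \<open>j\<close> and then
        \<open>d - 1\<close> forced zeros, so the induction hypothesis is used at
        \<open>r - d\<close>.\<close>
      have "completions j (j - d) (Suc r - d)
          \<approx> (if d - 1 \<le> q then fillings j {0, j - 1 - (d - 1)} (q - (d - 1)) else {})"
      proof (cases "d - 1 \<le> q")
        case True
        then show ?thesis
          using less.IH[of "q - (d - 1)" "j - d"] less.prems Suc
          by (simp add: Suc_diff_le)
      next
        case False
        then show ?thesis using less.prems Suc by (simp add: completions_empty)
      qed
      also have "\<dots> \<approx> fillings j {d - 1, j - 1} q"
        using less.prems by (intro eqpoll_sym[OF fillings_shift]) auto
      finally have 2: "completions j (j - d) (Suc r - d) \<approx> fillings j {d - 1, j - 1} q" .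
      \<comment> \<open>The branches are disjoint on either side, being told apart by the leading
        part or letter.\<close>
      have "?f ` completions j (d - 1) r \<union> ?g ` completions j (j - d) (Suc r - d)
          \<approx> (#) 1 ` (if d = 1 then {} else fillings j {0, d - 1} q) \<union>
            (#) j ` fillings j {d - 1, j - 1} q"
      proof (rule Un_eqpoll_cong)
        show "?f ` completions j (d - 1) r
            \<approx> (#) 1 ` (if d = 1 then {} else fillings j {0, d - 1} q)"
          using 1 by (subst inj_on_image_eqpoll_1, force simp: inj_on_def)
            (subst inj_on_image_eqpoll_2, simp_all)
        show "?g ` completions j (j - d) (Suc r - d) \<approx> (#) j ` fillings j {d - 1, j - 1} q"
          using 2 by (subst inj_on_image_eqpoll_1, force simp: inj_on_def)
            (subst inj_on_image_eqpoll_2, simp_all)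
      qed (use less.prems in \<open>auto simp: disjnt_def\<close>)
      then show ?thesis
        using rec fillings_rec[OF less.prems, of q] Suc by simp
    qed
  qed
qed

theorem theorem6p3:
  fixes j n :: nat
  assumes "j \<ge> 2" and "n > j"
  shows "\<exists>f. bij_betw f (indec_meanders_gt {1, j} n)
                        (displacement_perms {-2, -1, int j - 2} (n - 1))"
proof -
  obtain r where r: "n = Suc (Suc r)"
    using assms by (cases n; cases "n - 1") auto
  have "indec_meanders_gt {1, j} n \<approx> completions j (j - 1) (Suc r)"
    using assms r indec_meanders_gt_eq[of j n]
    by (auto intro!: inj_on_image_eqpoll_self simp: inj_on_def)
  also have "\<dots> \<approx> fillings j {0, j - 1} r"
    using assms by (intro completions_eqpoll_fillings) auto
  \<comment> \<open>From \<open>{0, 1}\<close> only the letter \<open>j\<close> is available, and it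
    leads to \<open>{0, j - 1}\<close>; prefixing it restores the length
    \<open>n - 1\<close>.\<close>
  also have "fillings j {0, j - 1} r \<approx> (#) j ` fillings j {0, j - 1} r"
    by (intro eqpoll_sym[OF inj_on_image_eqpoll_self]) auto
  also have "\<dots> = fillings j {0, 1} (n - 1)"
    using assms fillings_rec[of 1 j r] r by simp
  also have "\<dots> \<approx> displacement_perms {-2, -1, int j - 2} (n - 1)"
    by (rule eqpoll_sym[OF displacement_perms_eqpoll_fillings[OF assms(1)]])
  finally show ?thesis by (simp add: eqpoll_def)
qed

end
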